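(* Let $\mathsf G$ be a discrete group, $(\mathcal A,\alpha,\omega)$ a twisted $C^*$-dynamical system with group $\mathsf G$ and center-valued $2$-cocycle $\omega$, and $\mathcal L(\mathsf G)$ an admissible algebra. Then $\big(\mathscr K^{\mathcal L}_{\alpha,\omega}(\mathsf G\times\mathsf G;\mathcal A),\bullet_{\alpha,\omega},{}^{\bullet_{\alpha,\omega}},\|\cdot\|_{\mathscr K^{\mathcal L}}\big)$ is a Banach $*$-algebra.
   Context: Banach $*$-algebras have submultiplicative norm and isometric involution. For a discrete group $\mathsf G$ with unit $\mathsf e$, $\ell^1(\mathsf G)$ has product $(k\star l)(x)=\sum_{y}k(y)l(y^{-1}x)$ and involution $k^\star(x)=\overline{k(x^{-1})}$. An admissible algebra is a subspace $\mathcal L(\mathsf G)\subset\ell^1(\mathsf G)$ with its own complete norm $\|\cdot\|_{\mathcal L}$, stronger than the $\ell^1$-norm, such that (i) it is solid: if $|k(x)|\le|l(x)|$ for all $x$ and $l\in\mathcal L(\mathsf G)$, then $k\in\mathcal L(\mathsf G)$ and $\|k\|_{\mathcal L}\le\|l\|_{\mathcal L}$; (ii) $(\mathcal L(\mathsf G),\star,{}^\star,\|\cdot\|_{\mathcal L})$ is a unital Banach $*$-algebra. A twisted $C^*$-dynamical system $(\mathcal A,\alpha,\omega)$ with center-valued cocycle consists of a $C^*$-algebra $\mathcal A$, a map $\alpha:\mathsf G\to\mathrm{Aut}(\mathcal A)$ and a map $\omega:\mathsf G\times\mathsf G\to\mathcal{UM}(\mathcal A)$ (unitary group of the multiplier algebra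 $\mathcal M(\mathcal A)$, equal to $\mathcal A$ if $\mathcal A$ is unital) with values in the center of $\mathcal M(\mathcal A)$, such that for all $x,y,z$: $\alpha_x\circ\alpha_y=\alpha_{xy}$, $\omega(x,y)\omega(xy,z)=\alpha_x[\omega(y,z)]\omega(x,yz)$, $\omega(x,\mathsf e)=1=\omega(\mathsf e,x)$ (automorphisms are extended to $\mathcal M(\mathcal A)$). $\mathscr K^{\mathcal L}_{\alpha,\omega}(\mathsf G\times\mathsf G;\mathcal A)$ is the set of functions $K:\mathsf G\times\mathsf G\to\mathcal A$ for which there is $k\in\mathcal L(\mathsf G)$ with $\|K(x,y)\|_{\mathcal A}\le|k(xy^{-1})|$ for all $x,y$; its norm is $\|K\|_{\mathscr K^{\mathcal L}}=\inf\{\|k\|_{\mathcal L}\mid k\in\mathcal L(\mathsf G),\ \|K(x,y)\|_{\mathcal A}\le|k(xy^{-1})|\ \forall x,y\in\mathsf G\}$. Linear operations are pointwise; composition and involution are $$(K\bullet_{\alpha,\omega}L)(x,y)=\sum_{z\in\mathsf G}K(x,z)L(z,y)\,\alpha_{x^{-1}}[\omega(xz^{-1},zy^{-1})],\qquad K^{\bullet_{\alpha,\omega}}(x,y)=\alpha_{x^{-1}}[\omega(xy^{-1},yx^{-1})^*]\,K(y,x)^*.$$ *)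

theory Defs
  imports "HOL-Analysis.Analysis" "HOL-Library.Function_Algebras"
begin

section \<open>Banach star-algebras\<close>

text \<open>
  A complex Banach star-algebra carried by a linear subspace \<open>S\<close> of an ambient complex vector
  space. The multiplication, involution and norm are only constrained on \<open>S\<close>.
\<close>

locale banach_star_algebra = vector_space scale
  for scale :: "complex \<Rightarrow> 'v::ab_group_add \<Rightarrow> 'v" +
  fixes S :: "'v set"
    and mul :: "'v \<Rightarrow> 'v \<Rightarrow> 'v"
    and invol :: "'v \<Rightarrow> 'v"
    and nrm :: "'v \<Rightarrow> real"
  assumes subspace_carrier: "subspace S"
    and nrm_nonneg: "a \<in> S \<Longrightarrow> 0 \<le> nrm a"
    and nrm_eq_0_iff: "a \<in> S \<Longrightarrow> nrm a = 0 \<longleftrightarrow> a = 0"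
    and nrm_scale: "a \<in> S \<Longrightarrow> nrm (scale r a) = cmod r * nrm a"
    and nrm_triangle: "a \<in> S \<Longrightarrow> b \<in> S \<Longrightarrow> nrm (a + b) \<le> nrm a + nrm b"
    and nrm_complete:
      "(\<And>n. X n \<in> S) \<Longrightarrow>
       (\<And>e. e > 0 \<Longrightarrow> \<exists>N. \<forall>m\<ge>N. \<forall>n\<ge>N. nrm (X m - X n) < e) \<Longrightarrow>
       \<exists>a\<in>S. (\<lambda>n::nat. nrm (X n - a)) \<longlonglongrightarrow> 0"
    and mul_closed: "a \<in> S \<Longrightarrow> b \<in> S \<Longrightarrow> mul a b \<in> S"
    and mul_assoc: "a \<in> S \<Longrightarrow> b \<in> S \<Longrightarrow> c \<in> S \<Longrightarrow> mul (mul a b) c = mul a (mul b c)"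
    and mul_add_left: "a \<in> S \<Longrightarrow> b \<in> S \<Longrightarrow> c \<in> S \<Longrightarrow> mul (a + b) c = mul a c + mul b c"
    and mul_add_right: "a \<in> S \<Longrightarrow> b \<in> S \<Longrightarrow> c \<in> S \<Longrightarrow> mul a (b + c) = mul a b + mul a c"
    and mul_scale_left: "a \<in> S \<Longrightarrow> b \<in> S \<Longrightarrow> mul (scale r a) b = scale r (mul a b)"
    and mul_scale_right: "a \<in> S \<Longrightarrow> b \<in> S \<Longrightarrow> mul a (scale r b) = scale r (mul a b)"
    and nrm_mul: "a \<in> S \<Longrightarrow> b \<in> S \<Longrightarrow> nrm (mul a b) \<le> nrm a * nrm b"
    and invol_closed: "a \<in> S \<Longrightarrow> invol a \<in> S"
    and invol_invol: "a \<in> S \<Longrightarrow> invol (invol a) = a"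
    and invol_add: "a \<in> S \<Longrightarrow> b \<in> S \<Longrightarrow> invol (a + b) = invol a + invol b"
    and invol_scale: "a \<in> S \<Longrightarrow> invol (scale r a) = scale (cnj r) (invol a)"
    and invol_mul: "a \<in> S \<Longrightarrow> b \<in> S \<Longrightarrow> invol (mul a b) = mul (invol b) (invol a)"
    and nrm_invol: "a \<in> S \<Longrightarrow> nrm (invol a) = nrm a"

text \<open>The norm of the unit is not required to be 1.\<close>

locale unital_banach_star_algebra = banach_star_algebra +
  assumes unit_exists: "\<exists>u\<in>S. \<forall>a\<in>S. mul u a = a \<and> mul a u = a"


section \<open>Admissible algebras\<close>

text \<open>
  Groups are written additively, as elements of the class \<^class>\<open>group_add\<close>, which does
  \<^emph>\<open>not\<close> assume commutativity: \<open>x + y\<close>, \<open>- x\<close>, \<open>0\<close> and \<open>x - y\<close> stand for \<open>xy\<close>, \<open>x\<close>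
  inverse, the unit, and \<open>x\<close> times the inverse of \<open>y\<close>.
\<close>

definition l1 :: "('g \<Rightarrow> complex) set" where
  "l1 = {k. (\<lambda>x. cmod (k x)) summable_on UNIV}"

definition l1_norm :: "('g \<Rightarrow> complex) \<Rightarrow> real" where
  "l1_norm k = (\<Sum>\<^sub>\<infinity>x. cmod (k x))"

definition conv :: "('g::group_add \<Rightarrow> complex) \<Rightarrow> ('g \<Rightarrow> complex) \<Rightarrow> 'g \<Rightarrow> complex" where
  "conv k l = (\<lambda>x. \<Sum>\<^sub>\<infinity>y. k y * l (- y + x))"

definition conv_star :: "('g::group_add \<Rightarrow> complex) \<Rightarrow> 'g \<Rightarrow> complex" where
  "conv_star k = (\<lambda>x. cnj (k (- x)))"

text \<open>That the norm is stronger than the \<open>l1\<close>-norm is taken up to a constant.\<close>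

locale admissible_algebra =
  unital_banach_star_algebra "\<lambda>c k x. c * k x" L conv conv_star normL
  for L :: "('g::group_add \<Rightarrow> complex) set" and normL :: "('g \<Rightarrow> complex) \<Rightarrow> real" +
  assumes subset_l1: "L \<subseteq> l1"
    and stronger_than_l1: "\<exists>C. \<forall>k\<in>L. l1_norm k \<le> C * normL k"
    and solid: "l \<in> L \<Longrightarrow> (\<And>x. cmod (k x) \<le> cmod (l x)) \<Longrightarrow> k \<in> L \<and> normL k \<le> normL l"


section \<open>C*-algebras and their multipliers\<close>

text \<open>Not necessarily unital. Unitality of \<open>scaleC\<close> follows from \<open>scaleR_scaleC\<close>, and the
  isometry of \<open>star\<close> from the C*-identity.\<close>

class cstar_algebra = real_normed_algebra + banach +
  fixes scaleC :: "complex \<Rightarrow> 'a \<Rightarrow> 'a" (infixr "*\<^sub>C" 75)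
    and star :: "'a \<Rightarrow> 'a"
  assumes scaleR_scaleC: "r *\<^sub>R a = complex_of_real r *\<^sub>C a"
    and scaleC_add_right: "c *\<^sub>C (a + b) = c *\<^sub>C a + c *\<^sub>C b"
    and scaleC_add_left: "(c + d) *\<^sub>C a = c *\<^sub>C a + d *\<^sub>C a"
    and scaleC_scaleC: "c *\<^sub>C d *\<^sub>C a = (c * d) *\<^sub>C a"
    and norm_scaleC: "norm (c *\<^sub>C a) = cmod c * norm a"
    and mult_scaleC_left: "(c *\<^sub>C a) * b = c *\<^sub>C (a * b)"
    and mult_scaleC_right: "a * (c *\<^sub>C b) = c *\<^sub>C (a * b)"
    and star_star: "star (star a) = a"
    and star_add: "star (a + b) = star a + star b"
    and star_scaleC: "star (c *\<^sub>C a) = cnj c *\<^sub>C star a"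
    and star_mult: "star (a * b) = star b * star a"
    and cstar_identity: "norm (star a * a) = (norm a)\<^sup>2"

text \<open>
  Multipliers are double centralizers: a pair \<open>(l, r)\<close> represents the multiplier \<open>m\<close> with
  \<open>m a = l a\<close> and \<open>a m = r a\<close> for \<open>a\<close> in the algebra.
\<close>

type_synonym 'a multiplier = "('a \<Rightarrow> 'a) \<times> ('a \<Rightarrow> 'a)"

definition clinear_bounded :: "('a::cstar_algebra \<Rightarrow> 'a) \<Rightarrow> bool" where
  "clinear_bounded f \<longleftrightarrow> bounded_linear f \<and> (\<forall>c a. f (c *\<^sub>C a) = c *\<^sub>C f a)"

definition multipliers :: "'a::cstar_algebra multiplier set" where
  "multipliers = {(l, r). clinear_bounded l \<and> clinear_bounded r \<and>
     (\<forall>a b. l (a * b) = l a * b) \<and> (\<forall>a b. r (a * b) = a * r b) \<and> (\<forall>a b. r a * b = a * l b)}"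

definition mult_left :: "'a multiplier \<Rightarrow> 'a \<Rightarrow> 'a" where
  "mult_left m a = fst m a"

definition mult_right :: "'a \<Rightarrow> 'a multiplier \<Rightarrow> 'a" where
  "mult_right a m = snd m a"

definition m_one :: "'a multiplier" where
  "m_one = (id, id)"

definition m_mult :: "'a multiplier \<Rightarrow> 'a multiplier \<Rightarrow> 'a multiplier" where
  "m_mult m n = (fst m \<circ> fst n, snd n \<circ> snd m)"

definition m_star :: "'a::cstar_algebra multiplier \<Rightarrow> 'a multiplier" where
  "m_star m = (star \<circ> snd m \<circ> star, star \<circ> fst m \<circ> star)"

definition unitary_multipliers :: "'a::cstar_algebra multiplier set" where
  "unitary_multipliers =
     {u \<in> multipliers. m_mult (m_star u) u = m_one \<and> m_mult u (m_star u) = m_one}"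

definition multiplier_center :: "'a::cstar_algebra multiplier set" where
  "multiplier_center = {m \<in> multipliers. \<forall>n\<in>multipliers. m_mult m n = m_mult n m}"


section \<open>Twisted dynamical systems\<close>

definition star_automorphism :: "('a::cstar_algebra \<Rightarrow> 'a) \<Rightarrow> bool" where
  "star_automorphism \<phi> \<longleftrightarrow> bij \<phi> \<and>
     (\<forall>a b. \<phi> (a + b) = \<phi> a + \<phi> b) \<and> (\<forall>c a. \<phi> (c *\<^sub>C a) = c *\<^sub>C \<phi> a) \<and>
     (\<forall>a b. \<phi> (a * b) = \<phi> a * \<phi> b) \<and> (\<forall>a. \<phi> (star a) = star (\<phi> a))"

text \<open>The canonical extension of an automorphism to the multiplier algebra, determined by
  \<open>\<phi>(m) \<phi>(a) = \<phi>(m a)\<close> and \<open>\<phi>(a) \<phi>(m) = \<phi>(a m)\<close>.\<close>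

definition extend_aut :: "('a \<Rightarrow> 'a) \<Rightarrow> 'a multiplier \<Rightarrow> 'a multiplier" where
  "extend_aut \<phi> m = (\<phi> \<circ> fst m \<circ> inv \<phi>, \<phi> \<circ> snd m \<circ> inv \<phi>)"

locale twisted_dynamical_system =
  fixes \<alpha> :: "'g::group_add \<Rightarrow> 'a::cstar_algebra \<Rightarrow> 'a"
    and \<omega> :: "'g \<Rightarrow> 'g \<Rightarrow> 'a multiplier"
  assumes automorphism: "star_automorphism (\<alpha> x)"
    and cocycle_unitary: "\<omega> x y \<in> unitary_multipliers"
    and cocycle_central: "\<omega> x y \<in> multiplier_center"
    and action: "\<alpha> x \<circ> \<alpha> y = \<alpha> (x + y)"
    and cocycle: "m_mult (\<omega> x y) (\<omega> (x + y) z) =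
      m_mult (extend_aut (\<alpha> x) (\<omega> y z)) (\<omega> x (y + z))"
    and cocycle_unit_right: "\<omega> x 0 = m_one"
    and cocycle_unit_left: "\<omega> 0 x = m_one"


section \<open>Algebras of kernels\<close>

definition dominates :: "('g::group_add \<Rightarrow> complex) \<Rightarrow> ('g \<Rightarrow> 'g \<Rightarrow> 'a::cstar_algebra) \<Rightarrow> bool" where
  "dominates k K \<longleftrightarrow> (\<forall>x y. norm (K x y) \<le> cmod (k (x - y)))"

definition kernels ::
  "('g::group_add \<Rightarrow> complex) set \<Rightarrow> ('g \<Rightarrow> 'g \<Rightarrow> 'a::cstar_algebra) set" where
  "kernels L = {K. \<exists>k\<in>L. dominates k K}"

text \<open>Only meaningful on \<^term>\<open>kernels L\<close>, where the infimum is over a nonempty set.\<close>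

definition kernel_norm ::
  "('g::group_add \<Rightarrow> complex) set \<Rightarrow> (('g \<Rightarrow> complex) \<Rightarrow> real) \<Rightarrow>
   ('g \<Rightarrow> 'g \<Rightarrow> 'a::cstar_algebra) \<Rightarrow> real" where
  "kernel_norm L normL K = Inf {normL k | k. k \<in> L \<and> dominates k K}"

definition kernel_scale ::
  "complex \<Rightarrow> ('g \<Rightarrow> 'g \<Rightarrow> 'a::cstar_algebra) \<Rightarrow> 'g \<Rightarrow> 'g \<Rightarrow> 'a" where
  "kernel_scale c K = (\<lambda>x y. c *\<^sub>C K x y)"

definition kernel_comp ::
  "('g::group_add \<Rightarrow> 'a::cstar_algebra \<Rightarrow> 'a) \<Rightarrow> ('g \<Rightarrow> 'g \<Rightarrow> 'a multiplier) \<Rightarrow>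
   ('g \<Rightarrow> 'g \<Rightarrow> 'a) \<Rightarrow> ('g \<Rightarrow> 'g \<Rightarrow> 'a) \<Rightarrow> 'g \<Rightarrow> 'g \<Rightarrow> 'a" where
  "kernel_comp \<alpha> \<omega> K L = (\<lambda>x y. \<Sum>\<^sub>\<infinity>z.
     mult_right (K x z * L z y) (extend_aut (\<alpha> (- x)) (\<omega> (x - z) (z - y))))"

definition kernel_star ::
  "('g::group_add \<Rightarrow> 'a::cstar_algebra \<Rightarrow> 'a) \<Rightarrow> ('g \<Rightarrow> 'g \<Rightarrow> 'a multiplier) \<Rightarrow>
   ('g \<Rightarrow> 'g \<Rightarrow> 'a) \<Rightarrow> 'g \<Rightarrow> 'g \<Rightarrow> 'a" where
  "kernel_star \<alpha> \<omega> K = (\<lambda>x y.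
     mult_left (extend_aut (\<alpha> (- x)) (m_star (\<omega> (x - y) (y - x)))) (star (K y x)))"

end

theory Submission
  imports Defs
begin

text \<open>
  The twist by \<open>\<alpha>\<close> and \<open>\<omega>\<close> becomes transparent once it is read on the pair groupoid, whose
  arrows are the pairs \<open>(x, y)\<close>. Let \<open>P x z y\<close> denote multiplication by
  \<open>\<alpha> (- x)\<close> applied to \<open>\<omega> (x - z) (z - y)\<close>. Then the identities for \<open>\<omega>\<close> and the action say exactly
  that \<open>P\<close> is a normalized 2-cocycle on this groupoid with values in the central unitaries
  (\<open>phase_cocycle\<close>):
  \<open>P x z w \<circ> P x w y = P z w y \<circ> P x z y\<close>. The automorphisms have disappeared: the product of kernels is
  the groupoid convolution \<open>\<Sum>z. P x z y (K x z * M z y)\<close>, and the involution sends \<open>K\<close> to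
  \<open>star (P x y x (K y x))\<close>. Associativity (\<open>twisted_mul_assoc\<close>) is the cocycle identity together
  with an exchange of sums, and the involution laws (\<open>twisted_star_twisted_star\<close>,
  \<open>twisted_star_twisted_mul\<close>) are the cocycle identity along paths that return to earlier points.

  A central unitary, seen as a map of the algebra, is isometric by the C*-identity alone
  (\<open>norm_central_unitary\<close>). Hence the twist is invisible to norms. If \<open>k\<close> dominates \<open>K\<close> and \<open>m\<close>
  dominates \<open>M\<close>, then the convolution of \<open>|k|\<close> and \<open>|m|\<close> dominates the product
  (\<open>dominates_twisted_mul\<close>), and \<open>conv_star k\<close> dominates the involution of \<open>K\<close>. Submultiplicativity
  and isometry of the involution are thereby inherited from \<open>L\<close>. Solidity enters because the
  dominating functions have to be replaced by their moduli.

  Completeness (\<open>kernel_norm_complete\<close>) is also inherited from \<open>L\<close>. Along a subsequence with summable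
  differences, the dominating functions of the differences form an absolutely convergent series in
  \<open>L\<close>. Its tails dominate the distance to the pointwise limit, and their norms tend to \<open>0\<close>.
\<close>

section \<open>Elementary facts about C*-algebras\<close>

lemma norm_star [simp]: "norm (star a) = norm (a :: 'a::cstar_algebra)"
proof -
  have le: "norm b \<le> norm (star b)" for b :: 'a
  proof (cases "norm b = 0")
    case False
    have "norm b * norm b \<le> norm (star b) * norm b"
      using norm_mult_ineq[of "star b" b] cstar_identity[of b] by (simp add: power2_eq_square)
    then show ?thesis
      using False by simp
  qed simp
  show ?thesis
    using le[of a] le[of "star a"] by (simp add: star_star)
qed

lemma scaleC_one [simp]: "1 *\<^sub>C (a :: 'a::cstar_algebra) = a"
  using scaleR_scaleC[of 1 a] by simp

lemma bounded_linear_star: "bounded_linear (star :: 'a::cstar_algebra \<Rightarrow> 'a)"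
  by (rule bounded_linear_intro[where K = 1]) (auto simp: star_add scaleR_scaleC star_scaleC)

text \<open>
  An algebra without unit still separates its elements by multiplication: if every multiple of
  \<open>d = a - b\<close> vanishes, then so does \<open>star d * d\<close>, whose norm is the square of that of \<open>d\<close>.
\<close>

lemma eq_if_left_multiples_eq:
  fixes a b :: "'a::cstar_algebra"
  assumes "\<And>c. c * a = c * b"
  shows "a = b"
proof -
  have "star (a - b) * (a - b) = 0"
    by (simp add: right_diff_distrib assms)
  then have "(norm (a - b))\<^sup>2 = 0"
    using cstar_identity[of "a - b"] by simp
  then show ?thesis
    by simp
qed


section \<open>Central unitary multipliers as maps\<close>

text \<open>
  A central unitary multiplier acts on the algebra from the left and from the right in the same way,
  so it is recorded by a single map \<open>U\<close>. The last condition says that \<open>star \<circ> U \<circ> star\<close>, which is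
  multiplication by the adjoint, is a left inverse of \<open>U\<close>. All conditions are algebraic, so
  that they can be transported along automorphisms; boundedness follows from them.
\<close>

definition central_unitary :: "('a::cstar_algebra \<Rightarrow> 'a) \<Rightarrow> bool" where
  "central_unitary U \<longleftrightarrow>
     (\<forall>a b. U (a + b) = U a + U b) \<and> (\<forall>c a. U (c *\<^sub>C a) = c *\<^sub>C U a) \<and>
     (\<forall>a b. U (a * b) = U a * b) \<and> (\<forall>a b. U (a * b) = a * U b) \<and>
     (\<forall>a. star (U (star (U a))) = a)"

context
  fixes U :: "'a::cstar_algebra \<Rightarrow> 'a"
  assumes U: "central_unitary U"
begin

lemma central_unitary_add: "U (a + b) = U a + U b"
  and central_unitary_scaleC: "U (c *\<^sub>C a) = c *\<^sub>C U a"
  and central_unitary_mult_left: "U a * b = U (a * b)"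
  and central_unitary_mult_right: "a * U b = U (a * b)"
  using U unfolding central_unitary_def by metis+

lemma central_unitary_star: "U (star (U a)) = star a"
  using U unfolding central_unitary_def by (metis star_star)

text \<open>
  By centrality \<open>star (U a) * U a = U (star (U a)) * a\<close>, and by unitarity this is \<open>star a * a\<close>; now
  apply the C*-identity.
\<close>

lemma norm_central_unitary: "norm (U a) = norm a"
proof -
  have "star (U a) * U a = star a * a"
    by (simp add: central_unitary_mult_right central_unitary_star flip: central_unitary_mult_left)
  then have "(norm (U a))\<^sup>2 = (norm a)\<^sup>2"
    by (metis cstar_identity)
  then show ?thesis
    by simp
qed

lemma bounded_linear_central_unitary: "bounded_linear U"
  by (rule bounded_linear_intro[where K = 1])
    (auto simp: central_unitary_add scaleR_scaleC central_unitary_scaleC norm_central_unitary)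

end

text \<open>
  Both maps can be pushed onto different factors of a product \<open>c * a\<close>, where their order no longer
  matters; products determine an element.
\<close>

lemma central_unitary_commute:
  assumes "central_unitary U" "central_unitary V"
  shows "U (V a) = V (U a)"
proof (rule eq_if_left_multiples_eq)
  fix c
  have "c * U (V a) = U c * V a"
    using assms by (simp add: central_unitary_mult_left central_unitary_mult_right)
  also have "\<dots> = V (U c * a)"
    using assms(2) by (rule central_unitary_mult_right)
  also have "\<dots> = V (U (c * a))"
    using assms(1) by (simp add: central_unitary_mult_left)
  also have "\<dots> = c * V (U a)"
    using assms by (simp add: central_unitary_mult_right)
  finally show "c * U (V a) = c * V (U a)" .
qed

text \<open>
  For a double centralizer \<open>(l, r)\<close> in the centre, commuting with multiplication by algebra elements
  turns \<open>r\<close> into a two-sided module map, and then \<open>r a * b = a * l b\<close> forces \<open>l = r\<close>.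
\<close>

lemma snd_central_unitary_multiplier:
  assumes "u \<in> unitary_multipliers" "u \<in> multiplier_center"
  shows "central_unitary (snd u)"
proof -
  obtain l r where u: "u = (l, r)"
    by (cases u)
  have "u \<in> multipliers"
    using assms by (simp add: multiplier_center_def)
  then have lin: "clinear_bounded r" and r_mult: "r (a * b) = a * r b" and lr: "r a * b = a * l b"
    for a b
    by (simp_all add: u multipliers_def)
  \<comment> \<open>\<open>u\<close> commutes in particular with the multiplier given by \<open>b\<close> itself.\<close>
  have r_mult': "r (a * b) = r a * b" for a b
  proof -
    have "((*) b, \<lambda>x. x * b) \<in> multipliers"
      by (auto simp: multipliers_def clinear_bounded_def bounded_linear_mult_left
          bounded_linear_mult_right mult_scaleC_left mult_scaleC_right mult.assoc)
    then have "m_mult u ((*) b, \<lambda>x. x * b) = m_mult ((*) b, \<lambda>x. x * b) u"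
      using assms by (simp add: multiplier_center_def)
    then show ?thesis
      by (auto simp: u m_mult_def fun_eq_iff)
  qed
  have "l = r"
  proof (rule ext, rule eq_if_left_multiples_eq)
    show "c * l b = c * r b" for b c
      using lr r_mult r_mult' by metis
  qed
  moreover have "m_mult (m_star u) u = m_one"
    using assms by (simp add: unitary_multipliers_def)
  ultimately have "star (r (star (r a))) = a" for a
    by (auto simp: u m_mult_def m_star_def m_one_def fun_eq_iff)
  then show ?thesis
    using lin r_mult r_mult' by (auto simp: u central_unitary_def clinear_bounded_def linear_add
        bounded_linear.linear)
qed

text \<open>
  This is how the extension of an automorphism to multipliers acts on central unitaries. The
  defining identities are purely algebraic, and \<open>\<phi>\<close> and its inverse preserve them.
\<close>

lemma central_unitary_conjugate:
  assumes "star_automorphism \<phi>" "central_unitary U"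
  shows "central_unitary (\<phi> \<circ> U \<circ> inv \<phi>)"
proof -
  have bij: "bij \<phi>" and add: "\<phi> (a + b) = \<phi> a + \<phi> b" and scale: "\<phi> (c *\<^sub>C a) = c *\<^sub>C \<phi> a"
    and mult: "\<phi> (a * b) = \<phi> a * \<phi> b" and star: "\<phi> (star a) = star (\<phi> a)" for a b c
    using assms by (auto simp: star_automorphism_def)
  have inv1 [simp]: "inv \<phi> (\<phi> a) = a" and inv2 [simp]: "\<phi> (inv \<phi> a) = a" for a
    using bij by (simp_all add: bij_is_inj bij_is_surj surj_f_inv_f)
  have inv_add: "inv \<phi> (a + b) = inv \<phi> a + inv \<phi> b" for a b
    by (metis inv1 inv2 add)
  have inv_scale: "inv \<phi> (c *\<^sub>C a) = c *\<^sub>C inv \<phi> a" for a c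
    by (metis inv1 inv2 scale)
  have inv_mult: "inv \<phi> (a * b) = inv \<phi> a * inv \<phi> b" for a b
    by (metis inv1 inv2 mult)
  have U: "U (a + b) = U a + U b" "U (c *\<^sub>C a) = c *\<^sub>C U a" "U (a * b) = U a * b"
    "U (a * b) = a * U b" "star (U (star (U a))) = a" for a b c
    using assms(2) unfolding central_unitary_def by blast+
  have "\<phi> (U (inv \<phi> (a * b))) = \<phi> (U (inv \<phi> a)) * b" for a b
    by (simp add: inv_mult U(3) mult)
  moreover have "\<phi> (U (inv \<phi> (a * b))) = a * \<phi> (U (inv \<phi> b))" for a b
    by (simp add: inv_mult U(4) mult)
  moreover have "star (\<phi> (U (inv \<phi> (star (\<phi> (U (inv \<phi> a))))))) = a" for a
    by (simp add: U(5) flip: star)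
  ultimately show ?thesis
    by (simp add: central_unitary_def inv_add inv_scale U(1,2) add scale)
qed

section \<open>Dominating series in an admissible algebra\<close>

context banach_star_algebra
begin

lemma nrm_minus: "a \<in> S \<Longrightarrow> nrm (- a) = nrm a"
  using nrm_scale[of a "-1"] by simp

lemma nrm_zero: "nrm 0 = 0"
  using nrm_eq_0_iff subspace_0[OF subspace_carrier] by blast

lemma nrm_sum_le:
  assumes "\<And>j. j \<in> A \<Longrightarrow> k j \<in> S"
  shows "nrm (sum k A) \<le> (\<Sum>j\<in>A. nrm (k j))"
  using assms
proof (induction A rule: infinite_finite_induct)
  case (insert j A)
  then have "nrm (k j + sum k A) \<le> nrm (k j) + nrm (sum k A)"
    by (intro nrm_triangle subspace_sum[OF subspace_carrier]) auto
  with insert show ?case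
    by simp
qed (simp_all add: nrm_zero)

text \<open>
  The Weierstrass criterion for a norm that is complete on a subspace.
\<close>

lemma absolutely_convergent_series:
  fixes k :: "nat \<Rightarrow> 'v"
  assumes k: "\<And>j. k j \<in> S" and summable: "summable (\<lambda>j. nrm (k j))"
  shows "\<exists>s\<in>S. (\<lambda>n. nrm ((\<Sum>j<n. k j) - s)) \<longlonglongrightarrow> 0 \<and> nrm s \<le> (\<Sum>j. nrm (k j))"
proof -
  define p where "p n = (\<Sum>j<n. k j)" for n
  define t where "t n = (\<Sum>j<n. nrm (k j))" for n
  have p: "p n \<in> S" for n
    unfolding p_def using k by (intro subspace_sum[OF subspace_carrier])
  have diff: "nrm (p m - p n) \<le> \<bar>t m - t n\<bar>" if "n \<le> m" for m n
  proof -
    have "p m - p n = sum k {n..<m}" "t m - t n = (\<Sum>j=n..<m. nrm (k j))"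
      using that unfolding p_def t_def by (simp_all add: sum_diff_nat_ivl lessThan_atLeast0)
    then show ?thesis
      using nrm_sum_le[of "{n..<m}" k] k by simp
  qed
  have diff: "nrm (p m - p n) \<le> \<bar>t m - t n\<bar>" for m n
  proof (cases "n \<le> m")
    case False
    have "nrm (p m - p n) = nrm (p n - p m)"
      using nrm_minus[of "p n - p m"] p subspace_diff[OF subspace_carrier] by simp
    with diff[of m n] False show ?thesis
      by simp
  qed (rule diff)
  have "Cauchy t"
    using summable unfolding t_def summable_iff_convergent by (rule convergent_Cauchy)
  have p_Cauchy: "\<exists>N. \<forall>m\<ge>N. \<forall>n\<ge>N. nrm (p m - p n) < e" if e: "e > 0" for e
  proof -
    obtain N where "\<forall>m\<ge>N. \<forall>n\<ge>N. \<bar>t m - t n\<bar> < e"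
      using metric_CauchyD[OF \<open>Cauchy t\<close> e] by (auto simp: dist_real_def)
    then show ?thesis
      using le_less_trans[OF diff] by blast
  qed
  obtain s where s: "s \<in> S" "(\<lambda>n. nrm (p n - s)) \<longlonglongrightarrow> 0"
    using nrm_complete[of p, OF p p_Cauchy] by auto
  have "nrm s \<le> t n + nrm (p n - s)" for n
  proof -
    have "nrm (p n + - (p n - s)) \<le> nrm (p n) + nrm (- (p n - s))"
      using p s by (intro nrm_triangle subspace_neg[OF subspace_carrier]
          subspace_diff[OF subspace_carrier])
    also have "nrm (- (p n - s)) = nrm (p n - s)"
      using p s by (intro nrm_minus subspace_diff[OF subspace_carrier])
    also have "nrm (p n) \<le> t n"
      unfolding p_def t_def using k by (intro nrm_sum_le)
    finally show ?thesis
      by simp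
  qed
  moreover have "(\<lambda>n. t n + nrm (p n - s)) \<longlonglongrightarrow> (\<Sum>j. nrm (k j)) + 0"
    unfolding t_def by (intro tendsto_add summable_LIMSEQ summable s)
  ultimately have "nrm s \<le> (\<Sum>j. nrm (k j)) + 0"
    by (intro LIMSEQ_le_const) auto
  with s show ?thesis
    unfolding p_def by auto
qed

end

text \<open>
  A dominating function may always be replaced by its modulus, which by solidity lies in the same
  algebra and has the same norm. Moduli can be added and convolved without cancellation.
\<close>

definition modulus :: "('g \<Rightarrow> complex) \<Rightarrow> 'g \<Rightarrow> complex" where
  "modulus k = (\<lambda>x. complex_of_real (cmod (k x)))"

lemma cmod_modulus [simp]: "cmod (modulus k x) = cmod (k x)"
  by (simp add: modulus_def)

lemma cmod_le_l1_norm: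
  assumes "k \<in> l1"
  shows "cmod (k x) \<le> l1_norm k"
  using finite_sum_le_infsum[of "\<lambda>x. cmod (k x)" UNIV "{x}"] assms
  by (simp add: l1_def l1_norm_def)

context admissible_algebra
begin

lemma modulus_mem: "k \<in> L \<Longrightarrow> modulus k \<in> L"
  using solid[of k "modulus k"] by simp

lemma normL_modulus: "k \<in> L \<Longrightarrow> normL (modulus k) = normL k"
  by (rule antisym) (simp_all add: modulus_mem solid[THEN conjunct2])

lemma cmod_le_normL: "\<exists>C. \<forall>k\<in>L. \<forall>x. cmod (k x) \<le> C * normL k"
proof -
  obtain C where C: "\<And>k. k \<in> L \<Longrightarrow> l1_norm k \<le> C * normL k"
    using stronger_than_l1 by blast
  have "cmod (k x) \<le> C * normL k" if "k \<in> L" for k x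
  proof -
    have "cmod (k x) \<le> l1_norm k"
      using that subset_l1 by (intro cmod_le_l1_norm) auto
    also have "\<dots> \<le> C * normL k"
      using that by (rule C)
    finally show ?thesis .
  qed
  then show ?thesis
    by blast
qed

lemma normL_tendsto_0_imp_pointwise:
  assumes "\<And>n. k n \<in> L" "(\<lambda>n. normL (k n)) \<longlonglongrightarrow> 0"
  shows "(\<lambda>n. k n x) \<longlonglongrightarrow> 0"
proof -
  obtain C where C: "\<And>k x. k \<in> L \<Longrightarrow> cmod (k x) \<le> C * normL k"
    using cmod_le_normL by blast
  have lim: "(\<lambda>n. C * normL (k n)) \<longlonglongrightarrow> 0"
    using tendsto_mult_left[OF assms(2), of C] by simp
  show ?thesis
    by (intro Lim_null_comparison[OF _ lim] always_eventually allI C assms(1))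
qed

text \<open>
  Since the norm of \<open>L\<close> controls point values, a series that converges absolutely in norm also
  converges pointwise, to the same function. This produces one dominating function for infinitely
  many kernels at once.
\<close>

lemma dominating_series:
  fixes k :: "nat \<Rightarrow> 'g \<Rightarrow> complex"
  assumes k: "\<And>j. k j \<in> L" and summable: "summable (\<lambda>j. normL (k j))"
  shows "\<exists>s\<in>L. (\<forall>x. (\<lambda>j. k j x) sums s x) \<and> normL s \<le> (\<Sum>j. normL (k j))"
proof -
  obtain s where s: "s \<in> L" "(\<lambda>n. normL ((\<Sum>j<n. k j) - s)) \<longlonglongrightarrow> 0"
    "normL s \<le> (\<Sum>j. normL (k j))"
    using absolutely_convergent_series[OF assms] by blast
  have "(\<Sum>j<n. k j) - s \<in> L" for n
    using s k by (intro subspace_diff[OF subspace_carrier] subspace_sum[OF subspace_carrier])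
  then have "(\<lambda>n. ((\<Sum>j<n. k j) - s) x) \<longlonglongrightarrow> 0" for x
    using s(2) by (rule normL_tendsto_0_imp_pointwise)
  moreover have "(\<Sum>j<n. k j) x = (\<Sum>j<n. k j x)" for x n
    by (induction n) auto
  ultimately have "(\<lambda>j. k j x) sums s x" for x
    by (auto simp: sums_def intro: LIM_zero_cancel)
  with s show ?thesis
    by blast
qed

text \<open>
  The substitution \<open>u = x - z\<close> turns the sum bounding a composition of kernels into the
  convolution of the dominating functions at \<open>x - y\<close>.
\<close>

lemma has_sum_conv_modulus:
  assumes "k \<in> L" "l \<in> L"
  shows "((\<lambda>z. cmod (k (x - z)) * cmod (l (z - y))) has_sum
           cmod (conv (modulus k) (modulus l) (x - y))) UNIV"
proof -
  let ?f = "\<lambda>u. cmod (k u) * cmod (l (- u + (x - y)))"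
  have l1: "k \<in> l1" "l \<in> l1"
    using assms subset_l1 by auto
  have "?f summable_on UNIV"
  proof (rule summable_on_comparison_test)
    show "(\<lambda>u. cmod (k u) * l1_norm l) summable_on UNIV"
      using l1 by (intro summable_on_cmult_left) (simp add: l1_def)
    show "?f u \<le> cmod (k u) * l1_norm l" for u
      using l1 by (intro mult_left_mono cmod_le_l1_norm) auto
  qed auto
  then have sum: "(?f has_sum infsum ?f UNIV) UNIV"
    by (rule has_sum_infsum)
  have "conv (modulus k) (modulus l) (x - y) = of_real (infsum ?f UNIV)"
    unfolding conv_def modulus_def
    by (intro infsumI) (use has_sum_of_real[OF sum, where ?'a = complex] in simp)
  moreover have "infsum ?f UNIV \<ge> 0"
    by (intro infsum_nonneg) auto
  ultimately have conv_eq: "cmod (conv (modulus k) (modulus l) (x - y)) = infsum ?f UNIV"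
    by simp
  have bij: "bij_betw (\<lambda>z. x - z) UNIV UNIV"
    by (rule bij_betw_byWitness[where f' = "\<lambda>u. - u + x"])
      (auto simp: diff_add_eq_diff_diff_swap)
  have "- (x - z) + (x - y) = z - y" for z
    using add_diff_eq[of "z - x" x y] by simp
  then have "(\<lambda>z. cmod (k (x - z)) * cmod (l (z - y))) = (\<lambda>z. ?f (x - z))"
    by (simp only:)
  then show ?thesis
    using has_sum_reindex_bij_betw[OF bij, of ?f] sum by (simp only: conv_eq)
qed

end


section \<open>The normed space of kernels\<close>

interpretation kernel_space: vector_space
  "kernel_scale :: _ \<Rightarrow> ('g::group_add \<Rightarrow> 'g \<Rightarrow> 'a::cstar_algebra) \<Rightarrow> _"
  by unfold_locales
    (auto simp: kernel_scale_def fun_eq_iff scaleC_add_right scaleC_add_left scaleC_scaleC)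

lemma dominates_add:
  "dominates k K \<Longrightarrow> dominates l M \<Longrightarrow> dominates (modulus k + modulus l) (K + M)"
  unfolding dominates_def modulus_def
  by (auto simp flip: of_real_add intro!: norm_triangle_le add_mono)

lemma dominates_scale: "dominates k K \<Longrightarrow> dominates (\<lambda>x. c * k x) (kernel_scale c K)"
  by (auto simp: dominates_def kernel_scale_def norm_scaleC norm_mult mult_left_mono)

context admissible_algebra
begin

lemma subspace_kernels: "kernel_space.subspace (kernels L :: ('g \<Rightarrow> 'g \<Rightarrow> 'a::cstar_algebra) set)"
proof (rule kernel_space.subspaceI)
  have "dominates 0 (0 :: 'g \<Rightarrow> 'g \<Rightarrow> 'a)"
    by (simp add: dominates_def)
  then show "(0 :: 'g \<Rightarrow> 'g \<Rightarrow> 'a) \<in> kernels L"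
    using subspace_0[OF subspace_carrier] by (auto simp: kernels_def)
next
  fix K M :: "'g \<Rightarrow> 'g \<Rightarrow> 'a"
  assume "K \<in> kernels L" "M \<in> kernels L"
  then show "K + M \<in> kernels L"
    unfolding kernels_def
    using dominates_add subspace_add[OF subspace_carrier] modulus_mem by blast
next
  fix c and K :: "'g \<Rightarrow> 'g \<Rightarrow> 'a"
  assume "K \<in> kernels L"
  then show "kernel_scale c K \<in> kernels L"
    unfolding kernels_def
    using dominates_scale subspace_scale[OF subspace_carrier] by blast
qed

lemma kernel_norm_le:
  assumes "k \<in> L" "dominates k K"
  shows "kernel_norm L normL K \<le> normL k"
  unfolding kernel_norm_def
  using assms nrm_nonneg by (intro cInf_lower bdd_belowI[where m = 0]) auto

lemma kernel_norm_nonneg: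
  assumes "K \<in> kernels L"
  shows "0 \<le> kernel_norm L normL K"
  unfolding kernel_norm_def
  using assms nrm_nonneg by (intro cInf_greatest) (auto simp: kernels_def)

lemma dominator_near_kernel_norm:
  assumes "K \<in> kernels L" "kernel_norm L normL K < e"
  shows "\<exists>k\<in>L. dominates k K \<and> normL k < e"
  using cInf_lessD[of "{normL k |k. k \<in> L \<and> dominates k K}" e] assms
  unfolding kernel_norm_def kernels_def by fastforce

text \<open>
  The inequalities for the kernel norm below are proved for dominating functions first, where they
  are properties of the norm of \<open>L\<close>, and then passed to the limit along such sequences.
\<close>

lemma minimizing_dominators:
  assumes K: "K \<in> kernels L"
  shows "\<exists>k. (\<forall>n::nat. k n \<in> L \<and> dominates (k n) K) \<and>
    (\<lambda>n. normL (k n)) \<longlonglongrightarrow> kernel_norm L normL K"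
proof -
  have "\<forall>n::nat. \<exists>k\<in>L. dominates k K \<and> normL k < kernel_norm L normL K + 1 / Suc n"
    using K by (intro allI dominator_near_kernel_norm) auto
  then obtain k where k: "\<And>n::nat. k n \<in> L" "\<And>n. dominates (k n) K"
    "\<And>n. normL (k n) < kernel_norm L normL K + 1 / Suc n"
    by metis
  have "(\<lambda>n. kernel_norm L normL K + 1 / Suc n) \<longlonglongrightarrow> kernel_norm L normL K + 0"
    by (intro tendsto_add tendsto_const LIMSEQ_Suc[OF lim_1_over_n])
  then have lim: "(\<lambda>n. kernel_norm L normL K + 1 / Suc n) \<longlonglongrightarrow> kernel_norm L normL K"
    by simp
  have "(\<lambda>n. normL (k n)) \<longlonglongrightarrow> kernel_norm L normL K"
    by (intro tendsto_sandwich[OF _ _ tendsto_const lim] always_eventually allI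
        kernel_norm_le[OF k(1,2)] less_imp_le[OF k(3)])
  with k show ?thesis
    by blast
qed

text \<open>
  Point values of kernels are controlled by the kernel norm. This makes it a norm, and not only a
  seminorm.
\<close>

lemma norm_kernel_le:
  "\<exists>C. \<forall>K\<in>kernels L. \<forall>x y. norm (K x y) \<le> C * kernel_norm L normL K"
proof -
  obtain C where C: "\<forall>k\<in>L. \<forall>x. cmod (k x) \<le> C * normL k"
    using cmod_le_normL by blast
  have "norm (K x y) \<le> C * kernel_norm L normL K" if K: "K \<in> kernels L" for K x y
  proof -
    obtain k where k: "\<forall>n::nat. k n \<in> L \<and> dominates (k n) K"
      and lim: "(\<lambda>n. normL (k n)) \<longlonglongrightarrow> kernel_norm L normL K"
      using minimizing_dominators[OF K] by blast
    have "norm (K x y) \<le> C * normL (k n)" for n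
    proof -
      have "norm (K x y) \<le> cmod (k n (x - y))"
        using k by (simp add: dominates_def)
      also have "\<dots> \<le> C * normL (k n)"
        using k C by blast
      finally show ?thesis .
    qed
    then show ?thesis
      using tendsto_mult_left[OF lim, of C] by (intro LIMSEQ_le_const) auto
  qed
  then show ?thesis
    by blast
qed

lemma kernel_norm_eq_0_iff:
  assumes "K \<in> kernels L"
  shows "kernel_norm L normL K = 0 \<longleftrightarrow> K = 0"
proof
  assume "kernel_norm L normL K = 0"
  then have "norm (K x y) \<le> 0" for x y
    using norm_kernel_le assms by fastforce
  then show "K = 0"
    by (auto simp: fun_eq_iff)
next
  assume "K = 0"
  then have "kernel_norm L normL K \<le> normL 0"
    using subspace_0[OF subspace_carrier] by (intro kernel_norm_le) (auto simp: dominates_def)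
  then show "kernel_norm L normL K = 0"
    using kernel_norm_nonneg[OF assms] by (simp add: nrm_zero)
qed

lemma kernel_norm_scale_le:
  assumes K: "K \<in> kernels L"
  shows "kernel_norm L normL (kernel_scale c K) \<le> cmod c * kernel_norm L normL K"
proof -
  obtain k where k: "\<forall>n::nat. k n \<in> L \<and> dominates (k n) K"
    and lim: "(\<lambda>n. normL (k n)) \<longlonglongrightarrow> kernel_norm L normL K"
    using minimizing_dominators[OF K] by blast
  have "kernel_norm L normL (kernel_scale c K) \<le> cmod c * normL (k n)" for n
    using kernel_norm_le[OF subspace_scale[OF subspace_carrier], of "k n" c "kernel_scale c K"] k
    by (simp add: dominates_scale nrm_scale)
  then show ?thesis
    using tendsto_mult_left[OF lim, of "cmod c"] by (intro LIMSEQ_le_const) auto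
qed

text \<open>
  The inequality above, applied to the scalar \<open>inverse c\<close>, gives the reverse one.
\<close>

lemma kernel_norm_scale:
  assumes K: "K \<in> kernels L"
  shows "kernel_norm L normL (kernel_scale c K) = cmod c * kernel_norm L normL K"
proof (cases "c = 0")
  case True
  then show ?thesis
    using kernel_norm_eq_0_iff[OF kernel_space.subspace_0[OF subspace_kernels]] by simp
next
  case False
  have "kernel_norm L normL (kernel_scale (inverse c) (kernel_scale c K)) \<le>
      cmod (inverse c) * kernel_norm L normL (kernel_scale c K)"
    using kernel_space.subspace_scale[OF subspace_kernels K] by (rule kernel_norm_scale_le)
  then have "kernel_norm L normL K \<le> inverse (cmod c) * kernel_norm L normL (kernel_scale c K)"
    using False by (simp add: norm_inverse)
  then have "cmod c * kernel_norm L normL K \<le> kernel_norm L normL (kernel_scale c K)"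
    using False by (simp add: field_simps)
  with kernel_norm_scale_le[OF K] show ?thesis
    by (rule antisym)
qed

lemma kernel_norm_triangle:
  assumes K: "K \<in> kernels L" and M: "M \<in> kernels L"
  shows "kernel_norm L normL (K + M) \<le> kernel_norm L normL K + kernel_norm L normL M"
proof -
  obtain k where k: "\<forall>n::nat. k n \<in> L \<and> dominates (k n) K"
    and limk: "(\<lambda>n. normL (k n)) \<longlonglongrightarrow> kernel_norm L normL K"
    using minimizing_dominators[OF K] by blast
  obtain m where m: "\<forall>n::nat. m n \<in> L \<and> dominates (m n) M"
    and limm: "(\<lambda>n. normL (m n)) \<longlonglongrightarrow> kernel_norm L normL M"
    using minimizing_dominators[OF M] by blast
  have "kernel_norm L normL (K + M) \<le> normL (k n) + normL (m n)" for n
  proof -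
    have "kernel_norm L normL (K + M) \<le> normL (modulus (k n) + modulus (m n))"
      using k m by (intro kernel_norm_le dominates_add subspace_add[OF subspace_carrier] modulus_mem) auto
    also have "\<dots> \<le> normL (modulus (k n)) + normL (modulus (m n))"
      using k m by (intro nrm_triangle modulus_mem) auto
    finally show ?thesis
      using k m by (simp add: normL_modulus)
  qed
  then show ?thesis
    using tendsto_add[OF limk limm] by (intro LIMSEQ_le_const) auto
qed

lemma kernel_norm_uminus:
  assumes "K \<in> kernels L"
  shows "kernel_norm L normL (- K) = kernel_norm L normL K"
  using kernel_norm_scale[OF assms, of "-1"] by simp

text \<open>
  If consecutive differences are dominated by \<open>d j\<close> with norm below \<open>(1/2) ^ j\<close>, then the pointwise
  limit \<open>A\<close> exists as a telescoping series. The difference \<open>A - X i\<close> is dominated by the tail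
  \<open>s i\<close>, the sum of the moduli of all \<open>d j\<close> with \<open>j \<ge> i\<close>, an element of \<open>L\<close> of norm at most
  \<open>2 * (1/2) ^ i\<close>.
\<close>

lemma limit_of_fast_cauchy:
  fixes X :: "nat \<Rightarrow> 'g \<Rightarrow> 'g \<Rightarrow> 'a::cstar_algebra"
  assumes X: "\<And>j. X j \<in> kernels L"
    and fast: "\<And>j. kernel_norm L normL (X (Suc j) - X j) < (1/2) ^ j"
  shows "\<exists>A\<in>kernels L. \<forall>i. kernel_norm L normL (A - X i) \<le> 2 * (1/2) ^ i"
proof -
  have "\<exists>d\<in>L. dominates d (X (Suc j) - X j) \<and> normL d < (1/2) ^ j" for j
    using X fast by (intro dominator_near_kernel_norm kernel_space.subspace_diff[OF subspace_kernels])
  then obtain d where d: "\<And>j. d j \<in> L" "\<And>j. dominates (d j) (X (Suc j) - X j)"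
    "\<And>j. normL (d j) < (1/2) ^ j"
    by metis
  define c where "c i j = modulus (d (j + i))" for i j
  have c: "c i j \<in> L" "normL (c i j) \<le> (1/2) ^ i * (1/2) ^ j" for i j
    using d[of "j + i"] by (auto simp: c_def modulus_mem normL_modulus power_add mult.commute)
  have geo: "(\<lambda>j. (1/2) ^ i * (1/2::real) ^ j) sums (2 * (1/2) ^ i)" for i
    using sums_mult[OF geometric_sums[of "1/2::real"], of "(1/2) ^ i"] by (simp add: mult.commute)
  have csum: "summable (\<lambda>j. normL (c i j))" for i
    using c nrm_nonneg geo[of i]
    by (intro summable_comparison_test'[OF sums_summable[OF geo[of i]], of 0]) auto
  have "\<exists>s\<in>L. (\<forall>x. (\<lambda>j. c i j x) sums s x) \<and> normL s \<le> (\<Sum>j. normL (c i j))" for i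
    by (intro dominating_series c csum)
  then obtain s where s: "\<And>i. s i \<in> L" "\<And>i x. (\<lambda>j. c i j x) sums s i x"
    "\<And>i. normL (s i) \<le> (\<Sum>j. normL (c i j))"
    by metis
  have s_norm: "normL (s i) \<le> 2 * (1/2) ^ i" for i
    using s(3)[of i] suminf_le[OF c(2) csum sums_summable[OF geo], of i] sums_unique[OF geo[of i]]
    by linarith
  \<comment> \<open>The sum \<open>s i\<close> of moduli is real and nonnegative, hence equal to its own modulus.\<close>
  have cs: "(\<lambda>j. cmod (d (j + i) x)) sums cmod (s i x)" for i x
  proof -
    have "(\<lambda>j. cmod (d (j + i) x)) sums Re (s i x)"
      using sums_Re[OF s(2)[of i x]] by (simp add: c_def modulus_def)
    moreover have "Im (s i x) = 0"
      using sums_Im[OF s(2)[of i x]] by (simp add: c_def modulus_def sums_iff)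
    moreover have "0 \<le> Re (s i x)"
      using sums_le[OF _ sums_zero \<open>(\<lambda>j. cmod (d (j + i) x)) sums Re (s i x)\<close>] by simp
    ultimately show ?thesis
      by (simp add: cmod_eq_Re)
  qed
  have step: "norm (X (Suc j) x y - X j x y) \<le> cmod (d j (x - y))" for j x y
    using d(2)[of j] by (simp add: dominates_def)
  have tel: "summable (\<lambda>j. norm (X (Suc j) x y - X j x y))" for x y
  proof (rule summable_comparison_test')
    show "summable (\<lambda>j. cmod (d j (x - y)))"
      using sums_summable[OF cs[of 0 "x - y"]] by simp
  qed (use step in simp)
  define A where "A x y = X 0 x y + (\<Sum>j. X (Suc j) x y - X j x y)" for x y
  have tail: "A x y - X i x y = (\<Sum>j. X (Suc (j + i)) x y - X (j + i) x y)" for x y i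
  proof -
    have "(\<Sum>j<i. X (Suc j) x y - X j x y) = X i x y - X 0 x y"
      by (rule sum_lessThan_telescope)
    then show ?thesis
      using suminf_minus_initial_segment[OF summable_norm_cancel[OF tel[of x y]], of i]
      by (simp add: A_def)
  qed
  have dom: "dominates (s i) (A - X i)" for i
    unfolding dominates_def
  proof (intro allI)
    fix x y
    have sum: "summable (\<lambda>j. norm (X (Suc (j + i)) x y - X (j + i) x y))"
      using summable_ignore_initial_segment[OF tel[of x y], of i] by simp
    have "norm (A x y - X i x y) \<le> (\<Sum>j. norm (X (Suc (j + i)) x y - X (j + i) x y))"
      unfolding tail by (rule summable_norm[OF sum])
    also have "\<dots> \<le> (\<Sum>j. cmod (d (j + i) (x - y)))"
      by (intro suminf_le step sum sums_summable[OF cs])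
    also have "\<dots> = cmod (s i (x - y))"
      using cs sums_unique by metis
    finally show "norm ((A - X i) x y) \<le> cmod (s i (x - y))"
      by simp
  qed
  then have "A - X 0 \<in> kernels L"
    using s(1) by (auto simp: kernels_def)
  then have "A \<in> kernels L"
    using kernel_space.subspace_add[OF subspace_kernels _ X[of 0], of "A - X 0"] by simp
  moreover have "kernel_norm L normL (A - X i) \<le> 2 * (1/2) ^ i" for i
    using kernel_norm_le[OF s(1) dom, of i] s_norm[of i] by linarith
  ultimately show ?thesis
    by blast
qed

text \<open>
  A Cauchy sequence converges as soon as a subsequence does; the subsequence is chosen fast enough
  for the preceding lemma.
\<close>

lemma kernel_norm_complete:
  fixes X :: "nat \<Rightarrow> 'g \<Rightarrow> 'g \<Rightarrow> 'a::cstar_algebra"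
  assumes X: "\<And>n. X n \<in> kernels L"
    and cauchy: "\<And>e. e > 0 \<Longrightarrow> \<exists>N. \<forall>m\<ge>N. \<forall>n\<ge>N. kernel_norm L normL (X m - X n) < e"
  shows "\<exists>A\<in>kernels L. (\<lambda>n. kernel_norm L normL (X n - A)) \<longlonglongrightarrow> 0"
proof -
  have "\<forall>j. \<exists>N. \<forall>m\<ge>N. \<forall>n\<ge>N. kernel_norm L normL (X m - X n) < (1/2) ^ j"
    using cauchy by simp
  then obtain N where N: "\<And>j m n. N j \<le> m \<Longrightarrow> N j \<le> n \<Longrightarrow> kernel_norm L normL (X m - X n) < (1/2) ^ j"
    by metis
  \<comment> \<open>Taking maxima makes the indices monotone and keeps each at or above its threshold \<open>N j\<close>.\<close>
  define r where "r j = Max (N ` {..j})" for j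
  have r_ge: "N j \<le> r j" and r_mono: "r j \<le> r (Suc j)" for j
    unfolding r_def by (auto intro!: Max_mono)
  have "\<exists>A\<in>kernels L. \<forall>i. kernel_norm L normL (A - X (r i)) \<le> 2 * (1/2) ^ i"
  proof (rule limit_of_fast_cauchy)
    show "kernel_norm L normL (X (r (Suc j)) - X (r j)) < (1/2) ^ j" for j
      using r_ge[of j] r_mono[of j] by (intro N) auto
  qed (rule X)
  then obtain A where A: "A \<in> kernels L" "\<And>i. kernel_norm L normL (A - X (r i)) \<le> 2 * (1/2) ^ i"
    by blast
  have diff: "K - M \<in> kernels L" if "K \<in> kernels L" "M \<in> kernels L" for K M :: "'g \<Rightarrow> 'g \<Rightarrow> 'a"
    using that by (rule kernel_space.subspace_diff[OF subspace_kernels])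
  have "(\<lambda>n. kernel_norm L normL (X n - A)) \<longlonglongrightarrow> 0"
  proof (rule LIMSEQ_I)
    fix e :: real
    assume "0 < e"
    then obtain i where i: "(1/2) ^ i < e / 3"
      using real_arch_pow_inv[of "e / 3" "1/2"] by auto
    have "norm (kernel_norm L normL (X n - A) - 0) < e" if n: "r i \<le> n" for n
    proof -
      have split: "X n - A = (X n - X (r i)) + - (A - X (r i))"
        by (simp add: fun_eq_iff)
      have "kernel_norm L normL (X n - A) \<le>
          kernel_norm L normL (X n - X (r i)) + kernel_norm L normL (- (A - X (r i)))"
        unfolding split using X A by (intro kernel_norm_triangle diff kernel_space.subspace_neg[OF subspace_kernels])
      moreover have "kernel_norm L normL (- (A - X (r i))) = kernel_norm L normL (A - X (r i))"
        using X A by (intro kernel_norm_uminus diff)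
      moreover have "kernel_norm L normL (X n - X (r i)) < (1/2) ^ i"
        using n r_ge[of i] by (intro N) auto
      ultimately have "kernel_norm L normL (X n - A) < e"
        using A(2)[of i] i by linarith
      then show ?thesis
        using kernel_norm_nonneg[OF diff[OF X[of n] A(1)]] by (simp only: diff_zero real_norm_def abs_of_nonneg)
    qed
    then show "\<exists>n0. \<forall>n\<ge>n0. norm (kernel_norm L normL (X n - A) - 0) < e"
      by blast
  qed
  with A show ?thesis
    by blast
qed

end


section \<open>Convolution of kernels twisted by a cocycle on the pair groupoid\<close>

lemma bounded_linear_scaleC: "bounded_linear ((*\<^sub>C) c :: 'a::cstar_algebra \<Rightarrow> 'a)"
  by (rule bounded_linear_intro[where K = "cmod c"])
    (auto simp: scaleC_add_right scaleR_scaleC scaleC_scaleC norm_scaleC mult.commute)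

lemma infsum_bounded_linear:
  assumes "bounded_linear h" "f summable_on A"
  shows "(\<Sum>\<^sub>\<infinity>x\<in>A. h (f x)) = h (infsum f A)"
  using infsum_bounded_linear_strong[of h f A] summable_on_bounded_linear[OF assms] assms by simp

text \<open>
  \<open>P x z y\<close> is the unitary attached to the composable pair of arrows \<open>(x, z)\<close>, \<open>(z, y)\<close> of the pair
  groupoid. In the cocycle identity the four points are passed in the order \<open>x, z, w, y\<close>; it
  compares the two ways of composing three arrows.
\<close>

locale pair_groupoid_cocycle =
  fixes P :: "'x \<Rightarrow> 'x \<Rightarrow> 'x \<Rightarrow> 'a::cstar_algebra \<Rightarrow> 'a"
  assumes central_unitary: "central_unitary (P x z y)"
    and pair_cocycle: "P x z w (P x w y a) = P z w y (P x z y a)"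
    and unit_left: "P x x y a = a"
    and unit_right: "P x y y a = a"
begin

lemmas P_add = central_unitary_add[OF central_unitary]
  and P_scale = central_unitary_scaleC[OF central_unitary]
  and P_mult_left = central_unitary_mult_left[OF central_unitary]
  and P_mult_right = central_unitary_mult_right[OF central_unitary]
  and P_star = central_unitary_star[OF central_unitary]
  and norm_P = norm_central_unitary[OF central_unitary]
  and bounded_linear_P = bounded_linear_central_unitary[OF central_unitary]
  and P_commute = central_unitary_commute[OF central_unitary central_unitary]

text \<open>
  The cocycle identity along \<open>x, y, x, y\<close>, whose two other factors are trivial. It makes the
  involution below involutive.
\<close>

lemma P_loop_commute: "P x y x a = P y x y a"
  using pair_cocycle[of x y x y a] by (simp add: unit_left unit_right)

text \<open>
  The cocycle identity along \<open>x, y, z, x\<close> rewrites the two inner factors, and the one along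
  \<open>x, z, y, z\<close> collapses the outcome. This makes the involution below antimultiplicative.
\<close>

lemma P_loop_mult: "P x z y (P x y x (P y z x a)) = P z y z (P x z x a)"
proof -
  have "P x z y (P x y x (P y z x a)) = P x z y (P x y z (P x z x a))"
    using pair_cocycle[of x y z x a] P_commute by metis
  also have "\<dots> = P z y z (P x z x a)"
    using pair_cocycle[of x z y z "P x z x a"] by (simp add: unit_right)
  finally show ?thesis .
qed

definition twisted_mul :: "('x \<Rightarrow> 'x \<Rightarrow> 'a) \<Rightarrow> ('x \<Rightarrow> 'x \<Rightarrow> 'a) \<Rightarrow> 'x \<Rightarrow> 'x \<Rightarrow> 'a" where
  "twisted_mul K M = (\<lambda>x y. \<Sum>\<^sub>\<infinity>z. P x z y (K x z * M z y))"

text \<open>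
  The unitary is applied before the star. Applying its adjoint after the star gives the same
  element, so this is the usual formula for the involution.
\<close>

definition twisted_star :: "('x \<Rightarrow> 'x \<Rightarrow> 'a) \<Rightarrow> 'x \<Rightarrow> 'x \<Rightarrow> 'a" where
  "twisted_star K = (\<lambda>x y. star (P x y x (K y x)))"

lemma twisted_star_twisted_star: "twisted_star (twisted_star K) = K"
  by (intro ext) (simp add: twisted_star_def P_loop_commute[of x y for x y] P_star star_star)

end

locale twisted_kernels =
  pair_groupoid_cocycle P + admissible_algebra L normL
  for P :: "'g::group_add \<Rightarrow> 'g \<Rightarrow> 'g \<Rightarrow> 'a::cstar_algebra \<Rightarrow> 'a"
    and L :: "('g \<Rightarrow> complex) set" and normL :: "('g \<Rightarrow> complex) \<Rightarrow> real"
begin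

lemma norm_twisted_mul_term_le:
  assumes "dominates k K" "dominates m M"
  shows "norm (P x z y (K x z * M z y)) \<le> cmod (k (x - z)) * cmod (m (z - y))"
proof -
  have "norm (K x z * M z y) \<le> norm (K x z) * norm (M z y)"
    by (rule norm_mult_ineq)
  also have "\<dots> \<le> cmod (k (x - z)) * cmod (m (z - y))"
    using assms by (intro mult_mono) (auto simp: dominates_def)
  finally show ?thesis
    by (simp add: norm_P)
qed

lemma summable_twisted_mul:
  assumes "K \<in> kernels L" "M \<in> kernels L"
  shows "(\<lambda>z. P x z y (K x z * M z y)) summable_on UNIV"
proof -
  obtain k m where k: "k \<in> L" "dominates k K" and m: "m \<in> L" "dominates m M"
    using assms by (auto simp: kernels_def)
  have "(\<lambda>z. cmod (k (x - z)) * cmod (m (z - y))) summable_on UNIV"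
    using has_sum_conv_modulus[OF k(1) m(1)] by (rule has_sum_imp_summable)
  then have "(\<lambda>z. norm (P x z y (K x z * M z y))) summable_on UNIV"
    by (intro summable_on_comparison_test[OF _ norm_twisted_mul_term_le[OF k(2) m(2)]]) auto
  then show ?thesis
    by (rule abs_summable_summable)
qed

lemma conv_modulus_mem: "k \<in> L \<Longrightarrow> m \<in> L \<Longrightarrow> conv (modulus k) (modulus m) \<in> L"
  by (intro mul_closed modulus_mem)

text \<open>
  Unitaries do not change norms, so the twist disappears from the estimate and the untwisted
  convolution of the dominating functions remains.
\<close>

lemma dominates_twisted_mul:
  assumes k: "k \<in> L" "dominates k K" and m: "m \<in> L" "dominates m M"
  shows "dominates (conv (modulus k) (modulus m)) (twisted_mul K M)"
  unfolding dominates_def twisted_mul_def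
proof (intro allI)
  fix x y
  have "K \<in> kernels L" "M \<in> kernels L"
    using assms by (auto simp: kernels_def)
  then show "norm (\<Sum>\<^sub>\<infinity>z. P x z y (K x z * M z y)) \<le> cmod (conv (modulus k) (modulus m) (x - y))"
    by (rule norm_infsum_le[OF has_sum_infsum[OF summable_twisted_mul] has_sum_conv_modulus[OF k(1) m(1)]
          norm_twisted_mul_term_le[OF k(2) m(2)]])
qed

lemma twisted_mul_mem:
  assumes "K \<in> kernels L" "M \<in> kernels L"
  shows "twisted_mul K M \<in> kernels L"
proof -
  obtain k m where "k \<in> L" "dominates k K" "m \<in> L" "dominates m M"
    using assms by (auto simp: kernels_def)
  then have "conv (modulus k) (modulus m) \<in> L"
    "dominates (conv (modulus k) (modulus m)) (twisted_mul K M)"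
    by (auto intro: conv_modulus_mem dominates_twisted_mul)
  then show ?thesis
    by (auto simp: kernels_def)
qed

lemma kernel_norm_twisted_mul:
  assumes K: "K \<in> kernels L" and M: "M \<in> kernels L"
  shows "kernel_norm L normL (twisted_mul K M) \<le> kernel_norm L normL K * kernel_norm L normL M"
proof -
  obtain k where k: "\<And>n::nat. k n \<in> L" "\<And>n. dominates (k n) K"
    and limk: "(\<lambda>n. normL (k n)) \<longlonglongrightarrow> kernel_norm L normL K"
    using minimizing_dominators[OF K] by blast
  obtain m where m: "\<And>n::nat. m n \<in> L" "\<And>n. dominates (m n) M"
    and limm: "(\<lambda>n. normL (m n)) \<longlonglongrightarrow> kernel_norm L normL M"
    using minimizing_dominators[OF M] by blast
  have "kernel_norm L normL (twisted_mul K M) \<le> normL (k n) * normL (m n)" for n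
  proof -
    have "kernel_norm L normL (twisted_mul K M) \<le> normL (conv (modulus (k n)) (modulus (m n)))"
      by (intro kernel_norm_le conv_modulus_mem dominates_twisted_mul k m)
    also have "\<dots> \<le> normL (modulus (k n)) * normL (modulus (m n))"
      by (intro nrm_mul modulus_mem k m)
    finally show ?thesis
      by (simp add: normL_modulus k m)
  qed
  then show ?thesis
    using tendsto_mult[OF limk limm] by (intro LIMSEQ_le_const) auto
qed

lemma twisted_mul_add_left:
  assumes "K \<in> kernels L" "M \<in> kernels L" "N \<in> kernels L"
  shows "twisted_mul (K + M) N = twisted_mul K N + twisted_mul M N"
  using assms by (intro ext) (simp add: twisted_mul_def distrib_right P_add infsum_add summable_twisted_mul)

lemma twisted_mul_add_right:
  assumes "K \<in> kernels L" "M \<in> kernels L" "N \<in> kernels L"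
  shows "twisted_mul K (M + N) = twisted_mul K M + twisted_mul K N"
  using assms by (intro ext) (simp add: twisted_mul_def distrib_left P_add infsum_add summable_twisted_mul)

lemma twisted_mul_scale:
  assumes "K \<in> kernels L" "M \<in> kernels L"
  shows twisted_mul_scale_left: "twisted_mul (kernel_scale c K) M = kernel_scale c (twisted_mul K M)"
    and twisted_mul_scale_right: "twisted_mul K (kernel_scale c M) = kernel_scale c (twisted_mul K M)"
proof -
  have "(\<Sum>\<^sub>\<infinity>z. c *\<^sub>C P x z y (K x z * M z y)) = c *\<^sub>C (\<Sum>\<^sub>\<infinity>z. P x z y (K x z * M z y))" for x y
    by (rule infsum_bounded_linear[OF bounded_linear_scaleC summable_twisted_mul[OF assms]])
  then show "twisted_mul (kernel_scale c K) M = kernel_scale c (twisted_mul K M)"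
    and "twisted_mul K (kernel_scale c M) = kernel_scale c (twisted_mul K M)"
    by (auto simp: fun_eq_iff twisted_mul_def kernel_scale_def mult_scaleC_left mult_scaleC_right P_scale)
qed

text \<open>
  The dominating double series is summed first over \<open>z\<close>, which gives \<open>c = |k| * |m|\<close> (convolution),
  and then over \<open>w\<close>, which gives \<open>c * |n|\<close>; both exist because \<open>L\<close> is closed under convolution.
\<close>

lemma summable_twisted_mul_triple:
  assumes "K \<in> kernels L" "M \<in> kernels L" "N \<in> kernels L"
  shows "(\<lambda>(w, z). P x w y (P x z w (K x z * M z w * N w y))) summable_on UNIV \<times> UNIV"
proof -
  obtain k m n where k: "k \<in> L" "dominates k K" and m: "m \<in> L" "dominates m M"
    and n: "n \<in> L" "dominates n N"
    using assms by (auto simp: kernels_def)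
  let ?c = "conv (modulus k) (modulus m)"
  define g where "g = (\<lambda>(w, z). cmod (k (x - z)) * cmod (m (z - w)) * cmod (n (w - y)))"
  have inner: "((\<lambda>z. g (w, z)) has_sum cmod (?c (x - w)) * cmod (n (w - y))) UNIV" for w
    using has_sum_cmult_left[OF has_sum_conv_modulus[OF k(1) m(1)]] by (simp add: g_def)
  have "((\<lambda>w. cmod (?c (x - w)) * cmod (n (w - y))) has_sum cmod (conv (modulus ?c) (modulus n) (x - y))) UNIV"
    by (intro has_sum_conv_modulus conv_modulus_mem k m n)
  then have outer: "(\<lambda>w. cmod (?c (x - w)) * cmod (n (w - y))) summable_on UNIV"
    by (rule has_sum_imp_summable)
  have g_abs: "\<bar>g p\<bar> = g p" for p
    by (simp add: g_def split: prod.split)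
  have g_summable: "(\<lambda>p. norm (g p)) summable_on UNIV \<times> UNIV"
    unfolding Infinite_Sum.abs_summable_on_Sigma_iff
    using has_sum_imp_summable[OF inner] outer by (simp add: g_abs infsumI[OF inner] abs_mult)
  have term_le: "norm (P x w y (P x z w (K x z * M z w * N w y))) \<le> g (w, z)" for w z
  proof -
    have "norm (K x z * M z w * N w y) \<le> norm (K x z) * norm (M z w) * norm (N w y)"
      by (intro order_trans[OF norm_mult_ineq] mult_right_mono norm_mult_ineq) simp
    also have "\<dots> \<le> g (w, z)"
      using k m n unfolding g_def dominates_def by (auto intro!: mult_mono)
    finally show ?thesis
      by (simp add: norm_P)
  qed
  have "(\<lambda>p. norm (case p of (w, z) \<Rightarrow> P x w y (P x z w (K x z * M z w * N w y)))) summable_on UNIV \<times> UNIV"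
    using g_summable
    by (rule Infinite_Sum.abs_summable_on_comparison_test) (auto simp: g_abs term_le)
  then show ?thesis
    by (rule abs_summable_summable)
qed

text \<open>
  Both sides are iterated sums of the same double family: the cocycle identity equates the terms, and
  absolute summability permits the exchange of the sums.
\<close>

lemma twisted_mul_assoc:
  assumes K: "K \<in> kernels L" and M: "M \<in> kernels L" and N: "N \<in> kernels L"
  shows "twisted_mul (twisted_mul K M) N = twisted_mul K (twisted_mul M N)"
proof (intro ext)
  fix x y
  let ?T = "\<lambda>w z. P x w y (P x z w (K x z * M z w * N w y))"
  have left: "P x w y (twisted_mul K M x w * N w y) = (\<Sum>\<^sub>\<infinity>z. ?T w z)" for w
  proof -
    have "bounded_linear (\<lambda>a. P x w y (a * N w y))"
      by (intro bounded_linear_compose[OF bounded_linear_P] bounded_linear_mult_left)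
    from infsum_bounded_linear[OF this summable_twisted_mul[OF K M, of x w]] show ?thesis
      by (simp add: twisted_mul_def P_mult_left)
  qed
  have right: "P x z y (K x z * twisted_mul M N z y) = (\<Sum>\<^sub>\<infinity>w. ?T w z)" for z
  proof -
    have "P x z y (K x z * P z w y a) = P x w y (P x z w (K x z * a))" for w a
    proof -
      have "P x z y (K x z * P z w y a) = P x z y (P z w y (K x z * a))"
        by (simp only: P_mult_right)
      also have "\<dots> = P z w y (P x z y (K x z * a))"
        by (rule P_commute)
      also have "\<dots> = P x z w (P x w y (K x z * a))"
        by (rule pair_cocycle[symmetric])
      also have "\<dots> = P x w y (P x z w (K x z * a))"
        by (rule P_commute)
      finally show ?thesis .
    qed
    moreover have "bounded_linear (\<lambda>a. P x z y (K x z * a))"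
      by (intro bounded_linear_compose[OF bounded_linear_P] bounded_linear_mult_right)
    ultimately show ?thesis
      using infsum_bounded_linear[of "\<lambda>a. P x z y (K x z * a)", OF _ summable_twisted_mul[OF M N, of z y]]
      by (simp add: twisted_mul_def mult.assoc)
  qed
  have "twisted_mul (twisted_mul K M) N x y = (\<Sum>\<^sub>\<infinity>w. \<Sum>\<^sub>\<infinity>z. ?T w z)"
    by (simp only: twisted_mul_def[of "twisted_mul K M"] left)
  also have "\<dots> = (\<Sum>\<^sub>\<infinity>z. \<Sum>\<^sub>\<infinity>w. ?T w z)"
    by (rule infsum_swap_banach[OF summable_twisted_mul_triple[OF assms]])
  also have "\<dots> = twisted_mul K (twisted_mul M N) x y"
    by (simp only: twisted_mul_def[of K "twisted_mul M N"] right)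
  finally show "twisted_mul (twisted_mul K M) N x y = twisted_mul K (twisted_mul M N) x y" .
qed

text \<open>
  The terms agree one by one: \<open>P_loop_mult\<close> writes the unitary on the right as \<open>P x z y\<close> times the
  one on the left, and \<open>P x z y\<close> cancels against its adjoint inside the star.
\<close>

lemma twisted_star_twisted_mul:
  assumes K: "K \<in> kernels L" and M: "M \<in> kernels L"
  shows "twisted_star (twisted_mul K M) = twisted_mul (twisted_star M) (twisted_star K)"
proof (intro ext)
  fix x y
  have term_eq: "star (P x y x (P y z x (K y z * M z x))) =
      P x z y (twisted_star M x z * twisted_star K z y)" for z
  proof -
    have "twisted_star M x z * twisted_star K z y = star (P z y z (P x z x (K y z * M z x)))"
      by (simp add: twisted_star_def P_mult_left P_mult_right P_commute[of x z x z y z] flip: star_mult)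
    then show ?thesis
      by (simp add: P_star flip: P_loop_mult)
  qed
  have "bounded_linear (\<lambda>a. star (P x y x a))"
    by (intro bounded_linear_compose[OF bounded_linear_star] bounded_linear_P)
  from infsum_bounded_linear[OF this summable_twisted_mul[OF K M, of y x]]
  have "twisted_star (twisted_mul K M) x y = (\<Sum>\<^sub>\<infinity>z. star (P x y x (P y z x (K y z * M z x))))"
    by (simp add: twisted_star_def twisted_mul_def)
  then show "twisted_star (twisted_mul K M) x y = twisted_mul (twisted_star M) (twisted_star K) x y"
    by (simp only: term_eq twisted_mul_def)
qed

lemma dominates_twisted_star: "dominates k K \<Longrightarrow> dominates (conv_star k) (twisted_star K)"
  by (simp add: dominates_def twisted_star_def conv_star_def norm_P)

lemma twisted_star_mem: "K \<in> kernels L \<Longrightarrow> twisted_star K \<in> kernels L"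
  unfolding kernels_def using dominates_twisted_star invol_closed by blast

lemma kernel_norm_twisted_star:
  assumes K: "K \<in> kernels L"
  shows "kernel_norm L normL (twisted_star K) = kernel_norm L normL K"
proof -
  have le: "kernel_norm L normL (twisted_star M) \<le> kernel_norm L normL M" if M: "M \<in> kernels L" for M
  proof -
    obtain m where m: "\<And>n::nat. m n \<in> L" "\<And>n. dominates (m n) M"
      and lim: "(\<lambda>n. normL (m n)) \<longlonglongrightarrow> kernel_norm L normL M"
      using minimizing_dominators[OF M] by blast
    have "kernel_norm L normL (twisted_star M) \<le> normL (m n)" for n
      using kernel_norm_le[OF invol_closed dominates_twisted_star, of "m n" M] m by (simp add: nrm_invol)
    then show ?thesis
      using lim by (intro LIMSEQ_le_const) auto
  qed
  show ?thesis
    using le[OF K] le[OF twisted_star_mem[OF K]] by (simp add: twisted_star_twisted_star)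
qed

lemma twisted_star_add: "twisted_star (K + M) = twisted_star K + twisted_star M"
  by (intro ext) (simp add: twisted_star_def P_add star_add)

lemma twisted_star_scale: "twisted_star (kernel_scale c K) = kernel_scale (cnj c) (twisted_star K)"
  by (intro ext) (simp add: twisted_star_def kernel_scale_def P_scale star_scaleC)

lemma banach_star_algebra_kernels:
  "banach_star_algebra kernel_scale (kernels L) twisted_mul twisted_star (kernel_norm L normL)"
  by unfold_locales
    (rule twisted_star_twisted_star twisted_star_add twisted_star_scale
      | fact subspace_kernels kernel_norm_nonneg kernel_norm_eq_0_iff kernel_norm_scale
        kernel_norm_triangle kernel_norm_complete twisted_mul_mem twisted_mul_assoc
        twisted_mul_add_left twisted_mul_add_right twisted_mul_scale_left twisted_mul_scale_right
        kernel_norm_twisted_mul twisted_star_mem twisted_star_twisted_mul kernel_norm_twisted_star)+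

end


section \<open>The cocycle of a twisted dynamical system\<close>

context twisted_dynamical_system
begin

text \<open>
  The twist in the composition of kernels acts from the right, so it is the second component of a
  double centralizer.
\<close>

definition phase :: "'g \<Rightarrow> 'g \<Rightarrow> 'g \<Rightarrow> 'a \<Rightarrow> 'a" where
  "phase x z y = snd (extend_aut (\<alpha> (- x)) (\<omega> (x - z) (z - y)))"

lemma \<alpha>_add: "\<alpha> x (\<alpha> y a) = \<alpha> (x + y) a"
  using action[of x y] by (simp add: fun_eq_iff)

lemma bij_\<alpha>: "bij (\<alpha> x)"
  using automorphism by (simp add: star_automorphism_def)

lemma \<alpha>_0: "\<alpha> 0 a = a"
  using \<alpha>_add[of 0 0 a] bij_\<alpha>[of 0] by (metis add.left_neutral bij_pointE)

lemma inv_\<alpha>: "inv (\<alpha> x) = \<alpha> (- x)"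
  by (rule inv_equality) (simp_all add: \<alpha>_add \<alpha>_0)

lemma phase_eq: "phase x z y a = \<alpha> (- x) (snd (\<omega> (x - z) (z - y)) (\<alpha> x a))"
  by (simp add: phase_def extend_aut_def inv_\<alpha>)

lemma central_unitary_phase: "central_unitary (phase x z y)"
  using central_unitary_conjugate[OF automorphism
      snd_central_unitary_multiplier[OF cocycle_unitary cocycle_central]]
  by (simp add: phase_def extend_aut_def)

text \<open>
  Transport the cocycle identity for the triple \<open>x - z\<close>, \<open>z - w\<close>, \<open>w - y\<close> by \<open>\<alpha> (- x)\<close>. The
  automorphism \<open>\<alpha> (x - z)\<close> in that identity becomes \<open>\<alpha> (- z)\<close>, so the base point moves from \<open>x\<close>
  to \<open>z\<close>. Second components of double centralizers multiply in reverse, hence the final exchange.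
\<close>

lemma phase_cocycle: "phase x z w (phase x w y a) = phase z w y (phase x z y a)"
proof -
  have "(x - z) + (z - w) = x - w" "(z - w) + (w - y) = z - y" "- x + (x - z) = - z"
    by (simp_all add: add_diff_eq)
  then have "m_mult (\<omega> (x - z) (z - w)) (\<omega> (x - w) (w - y)) =
      m_mult (extend_aut (\<alpha> (x - z)) (\<omega> (z - w) (w - y))) (\<omega> (x - z) (z - y))"
    using cocycle[of "x - z" "z - w" "w - y"] by simp
  then have "snd (\<omega> (x - w) (w - y)) (snd (\<omega> (x - z) (z - w)) (\<alpha> x a)) =
      snd (\<omega> (x - z) (z - y)) (\<alpha> (x - z) (snd (\<omega> (z - w) (w - y)) (\<alpha> (- (x - z)) (\<alpha> x a))))"
    by (simp add: m_mult_def extend_aut_def fun_eq_iff inv_\<alpha>)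
  then have "phase x w y (phase x z w a) = phase x z y (phase z w y a)"
    by (simp add: phase_eq \<alpha>_add \<alpha>_0)
  then show ?thesis
    using central_unitary_commute[OF central_unitary_phase central_unitary_phase] by metis
qed

lemma pair_groupoid_cocycle_phase: "pair_groupoid_cocycle phase"
proof
  show "phase x x y a = a" "phase x y y a = a" for x y a
    by (simp_all add: phase_eq cocycle_unit_left cocycle_unit_right m_one_def \<alpha>_add \<alpha>_0)
qed (rule central_unitary_phase phase_cocycle)+

lemma kernel_comp_eq: "kernel_comp \<alpha> \<omega> = pair_groupoid_cocycle.twisted_mul phase"
  by (intro ext) (simp add: kernel_comp_def
      pair_groupoid_cocycle.twisted_mul_def[OF pair_groupoid_cocycle_phase]
      mult_right_def phase_def)

lemma kernel_star_eq: "kernel_star \<alpha> \<omega> = pair_groupoid_cocycle.twisted_star phase"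
proof (intro ext)
  fix K :: "'g \<Rightarrow> 'g \<Rightarrow> 'a" and x y
  have star: "\<alpha> z (star a) = star (\<alpha> z a)" for z a
    using automorphism by (simp add: star_automorphism_def)
  show "kernel_star \<alpha> \<omega> K x y = pair_groupoid_cocycle.twisted_star phase K x y"
    by (simp add: kernel_star_def pair_groupoid_cocycle.twisted_star_def[OF pair_groupoid_cocycle_phase]
        mult_left_def m_star_def extend_aut_def phase_eq inv_\<alpha> star star_star)
qed

end

theorem proposition3p3:
  fixes \<alpha> :: "'g::group_add \<Rightarrow> 'a::cstar_algebra \<Rightarrow> 'a"
    and \<omega> :: "'g \<Rightarrow> 'g \<Rightarrow> 'a multiplier"
    and L :: "('g \<Rightarrow> complex) set"
    and normL :: "('g \<Rightarrow> complex) \<Rightarrow> real"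
  assumes "twisted_dynamical_system \<alpha> \<omega>"
    and "admissible_algebra L normL"
  shows "banach_star_algebra kernel_scale (kernels L)
    (kernel_comp \<alpha> \<omega>) (kernel_star \<alpha> \<omega>) (kernel_norm L normL)"
proof -
  interpret twisted_dynamical_system \<alpha> \<omega>
    by fact
  interpret twisted_kernels phase L normL
    by (intro twisted_kernels.intro pair_groupoid_cocycle_phase assms)
  show ?thesis
    unfolding kernel_comp_eq kernel_star_eq by (rule banach_star_algebra_kernels)
qed

end
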